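(* Let $m \ge 2$ be an integer and let $\beta_m$ be the multinacci number of order $m$. The set of points $(\beta_m,\alpha) \in \Delta(\beta_m)$ for which $\Omega_{\beta_m,\alpha}$ is a subshift of finite type is dense in $\Delta(\beta_m)$.
   Context: For an integer $m\ge 2$, the multinacci number $\beta_m$ of order $m$ is the unique real solution in $(1,2)$ of $x^m = x^{m-1}+\dots+x+1$. For $\beta\in(1,2)$ set $\Delta(\beta) = \{(\beta,\alpha)\in\mathbb{R}^2 : 0\le\alpha\le 2-\beta\}$, with the Euclidean topology. For $\beta\in(1,2)$ and $\alpha\in[0,2-\beta]$ put $p=p_{\beta,\alpha}=(1-\alpha)/\beta$ and $J_{\beta,\alpha}=[-\alpha/(\beta-1),(1-\alpha)/(\beta-1)]$. The maps $T^{\pm}_{\beta,\alpha}:J_{\beta,\alpha}\to J_{\beta,\alpha}$ are: $T^+_{\beta,\alpha}(x)=\beta x+\alpha$ if $x<p$ and $\beta x+\alpha-1$ otherwise; $T^-_{\beta,\alpha}(x)=\beta x+\alpha$ if $x\le p$ and $\beta x+\alpha-1$ otherwise. The expansion maps $\tau^{\pm}_{\beta,\alpha}:J_{\beta,\alpha}\to\{0,1\}^{\mathbb{N}}$ are $\tau^{\pm}_{\beta,\alpha}(x)=(\omega_1^{\pm}(x),\omega_2^{\pm}(x),\dots)$, where $\omega_n^+(x)=0$ if $(T^+_{\beta,\alpha})^{n-1}(x)<p$ and $1$ otherwise, and $\omega_n^-(x)=0$ if $(T^-_{\beta,\alpha})^{n-1}(x)\le p$ and $1$ otherwise. Set $\Omega^{\pm}_{\beta,\alpha}=\tau^{\pm}_{\beta,\alpha}(J_{\beta,\alpha})$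 and $\Omega_{\beta,\alpha}=\Omega^+_{\beta,\alpha}\cup\Omega^-_{\beta,\alpha}$. A subshift is a closed subset $\Omega\subseteq\{0,1\}^{\mathbb{N}}$ (product topology) with $\sigma(\Omega)\subseteq\Omega$, where $\sigma$ is the left shift. It is of finite type if there is a finite set $F$ of finite words such that (i) for all $\nu\in\Omega$ and $n\in\mathbb{N}$ the length-$n$ prefix of $\nu$ is not in $F$; and (ii) for every $\nu\in\{0,1\}^{\mathbb{N}}\setminus\Omega$ there are integers $n>0$, $l\ge0$ such that the length-$n$ prefix of $\sigma^l(\nu)$ is in $F$. *)

theory Defs
  imports "HOL-Analysis.Analysis" "HOL-Library.Omega_Words_Fun"
begin

text \<open>
  The alphabet \<open>{0, 1}\<close> is represented by \<^typ>\<open>bool\<close> with \<open>False\<close> for 0 and \<open>True\<close> for 1; its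
  topology is discrete, so the topology of \<^typ>\<open>nat \<Rightarrow> bool\<close> is the product topology on
  \<open>{0, 1}\<^sup>\<nat>\<close>. Sequences are indexed from 0, so that the symbol at index \<open>n\<close> is the
  \<open>(n + 1)\<close>-st symbol of the sequence. The left shift is \<^term>\<open>suffix 1\<close>, and \<^term>\<open>suffix l\<close> is
  its \<open>l\<close>-fold iterate.
\<close>

definition subshift :: "(nat \<Rightarrow> bool) set \<Rightarrow> bool" where
  "subshift X \<longleftrightarrow> closed X \<and> suffix 1 ` X \<subseteq> X"

definition subshift_of_finite_type :: "(nat \<Rightarrow> bool) set \<Rightarrow> bool" where
  "subshift_of_finite_type X \<longleftrightarrow> subshift X \<and>
     (\<exists>F :: bool list set. finite F \<and>
        (\<forall>\<nu>\<in>X. \<forall>n>0. prefix n \<nu> \<notin> F) \<and>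
        (\<forall>\<nu>. \<nu> \<notin> X \<longrightarrow> (\<exists>n>0. \<exists>l. prefix n (suffix l \<nu>) \<in> F)))"

definition multinacci :: "nat \<Rightarrow> real" where
  "multinacci m = (THE x. 1 < x \<and> x < 2 \<and> x ^ m = (\<Sum>i<m. x ^ i))"

definition Delta :: "real \<Rightarrow> (real \<times> real) set" where
  "Delta \<beta> = {(\<beta>, \<alpha>) |\<alpha>. 0 \<le> \<alpha> \<and> \<alpha> \<le> 2 - \<beta>}"

definition crit :: "real \<Rightarrow> real \<Rightarrow> real" where
  "crit \<beta> \<alpha> = (1 - \<alpha>) / \<beta>"

definition J :: "real \<Rightarrow> real \<Rightarrow> real set" where
  "J \<beta> \<alpha> = {- \<alpha> / (\<beta> - 1) .. (1 - \<alpha>) / (\<beta> - 1)}"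

text \<open>
  The maps are total functions on \<^typ>\<open>real\<close>; for \<open>1 < \<beta> < 2\<close> and \<open>0 \<le> \<alpha> \<le> 2 - \<beta>\<close> they map
  \<open>J \<beta> \<alpha>\<close> into itself, and only their values there matter.
\<close>

definition T_plus :: "real \<Rightarrow> real \<Rightarrow> real \<Rightarrow> real" where
  "T_plus \<beta> \<alpha> x = (if x < crit \<beta> \<alpha> then \<beta> * x + \<alpha> else \<beta> * x + \<alpha> - 1)"

definition T_minus :: "real \<Rightarrow> real \<Rightarrow> real \<Rightarrow> real" where
  "T_minus \<beta> \<alpha> x = (if x \<le> crit \<beta> \<alpha> then \<beta> * x + \<alpha> else \<beta> * x + \<alpha> - 1)"

definition tau_plus :: "real \<Rightarrow> real \<Rightarrow> real \<Rightarrow> nat \<Rightarrow> bool" where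
  "tau_plus \<beta> \<alpha> x n = (\<not> (T_plus \<beta> \<alpha> ^^ n) x < crit \<beta> \<alpha>)"

definition tau_minus :: "real \<Rightarrow> real \<Rightarrow> real \<Rightarrow> nat \<Rightarrow> bool" where
  "tau_minus \<beta> \<alpha> x n = (\<not> (T_minus \<beta> \<alpha> ^^ n) x \<le> crit \<beta> \<alpha>)"

definition Omega :: "real \<Rightarrow> real \<Rightarrow> (nat \<Rightarrow> bool) set" where
  "Omega \<beta> \<alpha> = tau_plus \<beta> \<alpha> ` J \<beta> \<alpha> \<union> tau_minus \<beta> \<alpha> ` J \<beta> \<alpha>"

end

theory Submission
  imports Defs
begin

text \<open>
  Both \<open>T\<^sup>+\<close> and \<open>T\<^sup>-\<close> map the critical point \<open>p\<close> to a point of \<open>{0, 1}\<close>, and \<open>\<Omega>\<close> is described by the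
  kneading sequences \<open>\<tau>\<^sup>+(0)\<close> and \<open>\<tau>\<^sup>-(1)\<close>: it consists of the sequences in which every tail after a 0
  is at most \<open>\<tau>\<^sup>-(1)\<close> and every tail after a 1 is at least \<open>\<tau>\<^sup>+(0)\<close>. If the orbits of 0 and of 1 both
  hit \<open>p\<close>, the kneading sequences are periodic, and finitely many forbidden words express these
  conditions. For a multinacci \<open>\<beta>\<close> the orbits of 0 and 1 meet or return to 0 and 1 after \<open>m\<close> steps,
  so it is enough that the orbit of 0 hits \<open>p\<close>. The parameters \<open>\<alpha>\<close> with this property are dense:
  on an interval free of them, the \<open>n\<close>-th iterate of 0 would be affine in \<open>\<alpha>\<close> with a slope of at
  least \<open>n\<close>, although it stays in \<open>[0, 1]\<close>.
\<close>

section \<open>Subshifts defined by two kneading sequences\<close>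

text \<open>
  If \<open>v\<close> is the kneading sequence \<^term>\<open>tau_minus \<beta> \<alpha> 1\<close>, then \<open>obeys False v \<omega>\<close> says that each tail
  of \<open>\<omega>\<close> after a symbol 0 is lexicographically at most \<open>v\<close>. It is phrased through the words
  \<open>0 v\<^sub>0 \<dots> v\<^sub>j\<^sub>-\<^sub>1 1\<close> with \<open>v\<^sub>j = 0\<close>, which must not occur in \<open>\<omega>\<close>. With \<open>c = True\<close> the symbols and
  the order are exchanged, and \<open>v\<close> is \<^term>\<open>tau_plus \<beta> \<alpha> 0\<close>.
\<close>

definition obeys :: "bool \<Rightarrow> (nat \<Rightarrow> bool) \<Rightarrow> (nat \<Rightarrow> bool) \<Rightarrow> bool" where
  "obeys c v \<omega> \<longleftrightarrow>
     (\<forall>n j. \<omega> n = c \<longrightarrow> (\<forall>i<j. \<omega> (Suc n + i) = v i) \<longrightarrow> v j = c \<longrightarrow> \<omega> (Suc n + j) = c)"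

lemma obeysD:
  assumes "obeys c v \<omega>" "\<omega> n = c" "\<And>i. i < j \<Longrightarrow> \<omega> (Suc n + i) = v i" "v j = c"
  shows "\<omega> (Suc n + j) = c"
  using assms unfolding obeys_def by blast

lemma obeys_Not:
  "obeys (\<not> c) (\<lambda>n. \<not> v n) (\<lambda>n. \<not> \<omega> n) \<longleftrightarrow> obeys c v \<omega>"
  unfolding obeys_def by auto

lemma obeys_suffix:
  assumes "obeys c v \<omega>"
  shows "obeys c v (suffix l \<omega>)"
  unfolding obeys_def
proof (intro allI impI)
  fix n j
  assume "suffix l \<omega> n = c" "\<forall>i<j. suffix l \<omega> (Suc n + i) = v i" "v j = c"
  then show "suffix l \<omega> (Suc n + j) = c"
    using obeysD[OF assms, of "l + n" j] by (simp add: add.assoc)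
qed

text \<open>Each instance of the condition involves finitely many coordinates, and the alphabet is
  discrete, so it is clopen.\<close>

lemma closed_obeys: "closed {\<omega>. obeys c v \<omega>}"
proof -
  have coord: "continuous_on UNIV (\<lambda>\<omega> :: nat \<Rightarrow> bool. \<omega> k)" for k
    by (rule continuous_on_product_coordinates)
  have eq: "closed {\<omega>. \<omega> k = b}" for k :: nat and b :: bool
    by (rule closed_Collect_eq[OF coord continuous_on_const])
  have op: "open {\<omega>. \<omega> k = b}" for k :: nat and b :: bool
    using open_Collect_neq[OF coord continuous_on_const, of k "\<not> b"] by simp
  have "open {\<omega>. \<forall>i<j. \<omega> (Suc n + i) = v i}" for j n
  proof -
    have "{\<omega>. \<forall>i<j. \<omega> (Suc n + i) = v i} = (\<Inter>i\<in>{..<j}. {\<omega>. \<omega> (Suc n + i) = v i})"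
      by auto
    then show ?thesis
      by (simp only:) (intro open_INT ballI op finite_lessThan)
  qed
  then show ?thesis
    unfolding obeys_def
    by (intro closed_Collect_all closed_Collect_imp op eq closed_Collect_const open_Collect_const)
qed

text \<open>After agreement over a whole period, position \<open>n + M\<close> again carries
  \<open>c\<close>, because \<open>v (M - 1) = c\<close>, and what follows is compared with
  \<open>v\<close> from its start. Induction reduces everything to \<open>j < M\<close>, so finitely
  many words matter.\<close>

lemma obeys_periodic:
  assumes "M > 0" and per: "\<And>i. v (i + M) = v i" and last: "v (M - 1) = c"
    and short: "\<And>n j. j < M \<Longrightarrow> \<omega> n = c \<Longrightarrow> (\<forall>i<j. \<omega> (Suc n + i) = v i) \<Longrightarrow> v j = c
                  \<Longrightarrow> \<omega> (Suc n + j) = c"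
  shows "obeys c v \<omega>"
  unfolding obeys_def
proof (intro allI impI)
  fix n j
  assume "\<omega> n = c" "\<forall>i<j. \<omega> (Suc n + i) = v i" "v j = c"
  then show "\<omega> (Suc n + j) = c"
  proof (induction j arbitrary: n rule: less_induct)
    case (less j)
    show ?case
    proof (cases "j < M")
      case True
      then show ?thesis
        using short less.prems by blast
    next
      case False
      have "\<omega> (n + M) = v (M - 1)"
        using less.prems(2)[rule_format, of "M - 1"] False \<open>M > 0\<close> by simp
      moreover have "\<omega> (Suc (n + M) + i) = v i" if "i < j - M" for i
        using less.prems(2)[rule_format, of "i + M"] that per[of i] by (simp add: ac_simps)
      moreover have "v (j - M) = c"
        using per[of "j - M"] False less.prems(3) by simp
      ultimately have "\<omega> (Suc (n + M) + (j - M)) = c"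
        using less.IH[of "j - M" "n + M"] False \<open>M > 0\<close> last by simp
      then show ?thesis
        using False by simp
    qed
  qed
qed

definition forbidden :: "bool \<Rightarrow> (nat \<Rightarrow> bool) \<Rightarrow> nat \<Rightarrow> bool list" where
  "forbidden c v j = c # prefix j v @ [\<not> c]"

lemma prefix_eq_forbidden_iff:
  "prefix n \<omega> = forbidden c v j \<longleftrightarrow>
     n = Suc (Suc j) \<and> \<omega> 0 = c \<and> (\<forall>i<j. \<omega> (Suc i) = v i) \<and> \<omega> (Suc j) \<noteq> c"
proof -
  have split: "prefix (Suc (Suc j)) \<omega> = \<omega> 0 # map (\<lambda>i. \<omega> (Suc i)) [0..<j] @ [\<omega> (Suc j)]"
    by (rule nth_equalityI) (auto simp: nth_Cons nth_append less_Suc_eq split: nat.split)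
  show ?thesis
  proof (cases "n = Suc (Suc j)")
    case True
    show ?thesis
      unfolding True split forbidden_def by (auto simp: subsequence_def)
  next
    case False
    then have "length (prefix n \<omega>) \<noteq> length (forbidden c v j)"
      by (simp add: forbidden_def)
    then show ?thesis
      using False by metis
  qed
qed

lemma subshift_of_finite_type_obeys:
  assumes v: "M > 0" "\<And>i. v (i + M) = v i" "\<not> v (M - 1)"
    and u: "N > 0" "\<And>i. u (i + N) = u i" "u (N - 1)"
  shows "subshift_of_finite_type {\<omega>. obeys False v \<omega> \<and> obeys True u \<omega>}"
    (is "subshift_of_finite_type ?X")
proof -
  \<comment> \<open>Only words with \<open>j\<close> below the period are listed;
    \<open>obeys_periodic\<close> takes care of the longer ones.\<close>
  define F where "F = forbidden False v ` {j. j < M \<and> \<not> v j} \<union> forbidden True u ` {j. j < N \<and> u j}"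
  have "finite F"
    unfolding F_def by simp
  moreover have "prefix n \<nu> \<notin> F" if "\<nu> \<in> ?X" for \<nu> n
    using that obeysD[of False v \<nu> 0] obeysD[of True u \<nu> 0]
    by (auto simp: F_def prefix_eq_forbidden_iff)
  moreover have "\<exists>n>0. \<exists>l. prefix n (suffix l \<nu>) \<in> F" if "\<nu> \<notin> ?X" for \<nu>
  proof (rule ccontr)
    assume "\<not> ?thesis"
    then have avoid: "prefix n (suffix l \<nu>) \<notin> F" if "n > 0" for n l
      using that by blast
    have "obeys False v \<nu>"
    proof (rule obeys_periodic[where M = M])
      fix n j
      assume "j < M" "\<nu> n = False" "\<forall>i<j. \<nu> (Suc n + i) = v i" "v j = False"
      moreover have "prefix (Suc (Suc j)) (suffix n \<nu>) \<noteq> forbidden False v j"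
        using avoid[of "Suc (Suc j)" n] \<open>j < M\<close> \<open>v j = False\<close> by (auto simp: F_def)
      ultimately show "\<nu> (Suc n + j) = False"
        unfolding prefix_eq_forbidden_iff by simp
    qed (use v in auto)
    moreover have "obeys True u \<nu>"
    proof (rule obeys_periodic[where M = N])
      fix n j
      assume "j < N" "\<nu> n = True" "\<forall>i<j. \<nu> (Suc n + i) = u i" "u j = True"
      moreover have "prefix (Suc (Suc j)) (suffix n \<nu>) \<noteq> forbidden True u j"
        using avoid[of "Suc (Suc j)" n] \<open>j < N\<close> \<open>u j = True\<close> by (auto simp: F_def)
      ultimately show "\<nu> (Suc n + j) = True"
        unfolding prefix_eq_forbidden_iff by simp
    qed (use u in auto)
    ultimately show False
      using that by simp
  qed
  moreover have "subshift ?X"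
    unfolding subshift_def by (auto intro!: closed_Collect_conj closed_obeys obeys_suffix)
  ultimately show ?thesis
    unfolding subshift_of_finite_type_def by blast
qed

section \<open>Orbits and expansions\<close>

text \<open>The digits are not tied to the position of the points, so orbits of both maps and
  projections of the tails of any sequence are covered at once.\<close>

definition is_orbit :: "real \<Rightarrow> real \<Rightarrow> (nat \<Rightarrow> bool) \<Rightarrow> (nat \<Rightarrow> real) \<Rightarrow> bool" where
  "is_orbit \<beta> \<alpha> d a \<longleftrightarrow> (\<forall>i. a (Suc i) = \<beta> * a i + \<alpha> - of_bool (d i))"

lemma is_orbit_step: "is_orbit \<beta> \<alpha> d a \<Longrightarrow> a (Suc i) = \<beta> * a i + \<alpha> - of_bool (d i)"
  unfolding is_orbit_def by blast

lemma is_orbit_shift: "is_orbit \<beta> \<alpha> d a \<Longrightarrow> is_orbit \<beta> \<alpha> (\<lambda>i. d (n + i)) (\<lambda>i. a (n + i))"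
  unfolding is_orbit_def by simp

lemma is_orbit_diff:
  assumes "is_orbit \<beta> \<alpha> d a" "is_orbit \<beta> \<alpha> e b" "\<And>i. i < j \<Longrightarrow> d i = e i"
  shows "a j - b j = \<beta> ^ j * (a 0 - b 0)"
  using assms(3)
proof (induction j)
  case (Suc j)
  have "a (Suc j) - b (Suc j) = \<beta> * (a j - b j)"
    using Suc.prems[of j] is_orbit_step[OF assms(1), of j] is_orbit_step[OF assms(2), of j]
    by (simp only: algebra_simps)
  then show ?case
    using Suc by simp
qed simp

lemma is_orbit_T_plus: "is_orbit \<beta> \<alpha> (tau_plus \<beta> \<alpha> x) (\<lambda>n. (T_plus \<beta> \<alpha> ^^ n) x)"
  by (simp add: is_orbit_def tau_plus_def T_plus_def)

lemma is_orbit_T_minus: "is_orbit \<beta> \<alpha> (tau_minus \<beta> \<alpha> x) (\<lambda>n. (T_minus \<beta> \<alpha> ^^ n) x)"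
  by (simp add: is_orbit_def tau_minus_def T_minus_def)

lemma T_plus_funpow_Suc:
  "(T_plus \<beta> \<alpha> ^^ Suc n) x = \<beta> * (T_plus \<beta> \<alpha> ^^ n) x + \<alpha> - of_bool (tau_plus \<beta> \<alpha> x n)"
  using is_orbit_step[OF is_orbit_T_plus] .

lemma T_minus_funpow_Suc:
  "(T_minus \<beta> \<alpha> ^^ Suc n) x = \<beta> * (T_minus \<beta> \<alpha> ^^ n) x + \<alpha> - of_bool (tau_minus \<beta> \<alpha> x n)"
  using is_orbit_step[OF is_orbit_T_minus] .

text \<open>Solving the recursion of \<open>is_orbit\<close> backwards for a bounded orbit with
  digits \<open>\<omega>\<close> gives this series for its starting point.\<close>

definition proj :: "real \<Rightarrow> real \<Rightarrow> (nat \<Rightarrow> bool) \<Rightarrow> real" where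
  "proj \<beta> \<alpha> \<omega> = (\<Sum>k. (of_bool (\<omega> k) - \<alpha>) / \<beta> ^ Suc k)"

locale intermediate_beta =
  fixes \<beta> \<alpha> :: real
  assumes beta_gt_1: "1 < \<beta>" and beta_less_2: "\<beta> < 2"
    and alpha_nonneg: "0 \<le> \<alpha>" and alpha_le: "\<alpha> \<le> 2 - \<beta>"
begin

lemma beta_pos: "0 < \<beta>"
  using beta_gt_1 by simp

lemma reflected: "intermediate_beta \<beta> (2 - \<beta> - \<alpha>)"
  using beta_gt_1 beta_less_2 alpha_nonneg alpha_le by unfold_locales auto

lemma less_crit_iff: "x < crit \<beta> \<alpha> \<longleftrightarrow> \<beta> * x + \<alpha> < 1"
  using beta_pos by (simp add: crit_def pos_less_divide_eq algebra_simps)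

lemma le_crit_iff: "x \<le> crit \<beta> \<alpha> \<longleftrightarrow> \<beta> * x + \<alpha> \<le> 1"
  using beta_pos by (simp add: crit_def pos_le_divide_eq algebra_simps)

lemma tau_plus_iff: "tau_plus \<beta> \<alpha> x n \<longleftrightarrow> 1 \<le> \<beta> * (T_plus \<beta> \<alpha> ^^ n) x + \<alpha>"
  by (simp add: tau_plus_def less_crit_iff not_less)

lemma tau_minus_iff: "tau_minus \<beta> \<alpha> x n \<longleftrightarrow> 1 < \<beta> * (T_minus \<beta> \<alpha> ^^ n) x + \<alpha>"
  by (simp add: tau_minus_def le_crit_iff not_le)

text \<open>
  Conjugation by \<open>x \<mapsto> 1 - x\<close> exchanges the two maps and the two symbols, and it replaces \<open>\<alpha>\<close> by
  \<open>2 - \<beta> - \<alpha>\<close>. So only one of each pair of symmetric facts needs a proof.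
\<close>

lemma T_plus_reflect: "T_plus \<beta> (2 - \<beta> - \<alpha>) (1 - x) = 1 - T_minus \<beta> \<alpha> x"
proof -
  interpret r: intermediate_beta \<beta> "2 - \<beta> - \<alpha>"
    by (rule reflected)
  show ?thesis
    unfolding T_plus_def T_minus_def r.less_crit_iff le_crit_iff by (auto simp: algebra_simps)
qed

lemma T_plus_funpow_reflect:
  "(T_plus \<beta> (2 - \<beta> - \<alpha>) ^^ n) (1 - x) = 1 - (T_minus \<beta> \<alpha> ^^ n) x"
  by (induction n) (auto simp: T_plus_reflect)

lemma tau_plus_reflect: "tau_plus \<beta> (2 - \<beta> - \<alpha>) (1 - x) = (\<lambda>n. \<not> tau_minus \<beta> \<alpha> x n)"
proof -
  interpret r: intermediate_beta \<beta> "2 - \<beta> - \<alpha>"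
    by (rule reflected)
  show ?thesis
    unfolding r.tau_plus_iff tau_minus_iff fun_eq_iff T_plus_funpow_reflect
    by (auto simp: algebra_simps)
qed

lemma tau_minus_reflect: "tau_minus \<beta> (2 - \<beta> - \<alpha>) (1 - x) = (\<lambda>n. \<not> tau_plus \<beta> \<alpha> x n)"
  using intermediate_beta.tau_plus_reflect[OF reflected, of "1 - x"] by simp

text \<open>A point reached by a 0 is at most 1, and equal digits multiply its distance to the orbit
  of 1 by \<beta>. So where the orbit of 1 is not right of the critical point, neither is this one.
  The hypothesis \<open>strict\<close> settles ties: every visit to the critical point gets the same
  digit.\<close>

lemma obeys_tau_minus_1:
  assumes d: "is_orbit \<beta> \<alpha> d a"
    and lower: "\<And>i. d i \<Longrightarrow> 1 \<le> \<beta> * a i + \<alpha>" and upper: "\<And>i. \<not> d i \<Longrightarrow> \<beta> * a i + \<alpha> \<le> 1"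
    and strict: "(\<forall>i. d i \<longrightarrow> 1 < \<beta> * a i + \<alpha>) \<or> (\<forall>i. \<not> d i \<longrightarrow> \<beta> * a i + \<alpha> < 1)"
  shows "obeys False (tau_minus \<beta> \<alpha> 1) d"
  unfolding obeys_def
proof (intro allI impI)
  fix n j
  assume n: "d n = False" and agree: "\<forall>i<j. d (Suc n + i) = tau_minus \<beta> \<alpha> 1 i"
    and j: "tau_minus \<beta> \<alpha> 1 j = False"
  define b where "b = (T_minus \<beta> \<alpha> ^^ j) 1"
  have "a (Suc n + j) - b = \<beta> ^ j * (a (Suc n) - 1)"
    using is_orbit_diff[OF is_orbit_shift[OF d, of "Suc n"] is_orbit_T_minus] agree
    by (simp add: b_def)
  then have "a (Suc n + j) = b + \<beta> ^ j * (a (Suc n) - 1)"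
    by simp
  then have diff: "\<beta> * a (Suc n + j) + \<alpha> = \<beta> * b + \<alpha> + \<beta> ^ Suc j * (a (Suc n) - 1)"
    by (simp only:) (simp add: algebra_simps)
  have b: "\<beta> * b + \<alpha> \<le> 1"
    using j by (simp add: b_def tau_minus_iff)
  have step: "a (Suc n) = \<beta> * a n + \<alpha>"
    using is_orbit_step[OF d, of n] n by simp
  have "\<beta> ^ Suc j * (a (Suc n) - 1) \<le> 0"
    using beta_pos upper[of n] n step by (intro mult_nonneg_nonpos) auto
  moreover have "\<beta> ^ Suc j * (a (Suc n) - 1) < 0" if "\<forall>i. \<not> d i \<longrightarrow> \<beta> * a i + \<alpha> < 1"
    using beta_pos that n step by (intro mult_pos_neg) auto
  ultimately show "d (Suc n + j) = False"
    using strict lower[of "Suc n + j"] diff b by fastforce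
qed

lemma tau_obeys_tau_minus_1:
  "obeys False (tau_minus \<beta> \<alpha> 1) (tau_plus \<beta> \<alpha> x)"
  "obeys False (tau_minus \<beta> \<alpha> 1) (tau_minus \<beta> \<alpha> x)"
  by (rule obeys_tau_minus_1[OF is_orbit_T_plus]; auto simp: tau_plus_iff)
    (rule obeys_tau_minus_1[OF is_orbit_T_minus]; auto simp: tau_minus_iff)

lemma tau_minus_1_reflect: "tau_minus \<beta> (2 - \<beta> - \<alpha>) 1 = (\<lambda>n. \<not> tau_plus \<beta> \<alpha> 0 n)"
  using tau_minus_reflect[of 0] by simp

lemma obeys_reflect:
  "obeys False (tau_minus \<beta> (2 - \<beta> - \<alpha>) 1) (\<lambda>n. \<not> \<omega> n) \<longleftrightarrow> obeys True (tau_plus \<beta> \<alpha> 0) \<omega>"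
  using obeys_Not[of True "tau_plus \<beta> \<alpha> 0" \<omega>] by (simp add: tau_minus_1_reflect)

lemma tau_obeys_tau_plus_0:
  "obeys True (tau_plus \<beta> \<alpha> 0) (tau_plus \<beta> \<alpha> x)"
  "obeys True (tau_plus \<beta> \<alpha> 0) (tau_minus \<beta> \<alpha> x)"
  using intermediate_beta.tau_obeys_tau_minus_1[OF reflected, of "1 - x"]
  by (simp_all add: tau_plus_reflect tau_minus_reflect obeys_reflect)

section \<open>Points represented by digit sequences\<close>

lemma sums_geometric: "(\<lambda>k. c / \<beta> ^ Suc k) sums (c / (\<beta> - 1))"
proof -
  have "(\<lambda>k. c / \<beta> * (1 / \<beta>) ^ k) sums (c / \<beta> * (1 / (1 - 1 / \<beta>)))"
    using beta_gt_1 by (intro sums_mult geometric_sums) simp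
  moreover have "c / \<beta> * (1 / (1 - 1 / \<beta>)) = c / (\<beta> - 1)"
    using beta_gt_1 by (simp add: field_simps)
  ultimately have "(\<lambda>k. c / \<beta> * (1 / \<beta>) ^ k) sums (c / (\<beta> - 1))"
    by (simp only:)
  then show ?thesis
    by (simp add: power_divide)
qed

lemma summable_proj: "summable (\<lambda>k. (of_bool (\<omega> k) - \<alpha>) / \<beta> ^ Suc k)"
proof (rule summable_comparison_test')
  show "summable (\<lambda>k. 1 / \<beta> ^ Suc k)"
    using sums_geometric by (rule sums_summable)
  show "norm ((of_bool (\<omega> k) - \<alpha>) / \<beta> ^ Suc k) \<le> 1 / \<beta> ^ Suc k" for k
  proof -
    have "\<bar>of_bool (\<omega> k) - \<alpha>\<bar> \<le> 1"
      using beta_gt_1 alpha_nonneg alpha_le by (cases "\<omega> k") auto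
    then show ?thesis
      using beta_pos by (simp add: abs_mult divide_right_mono)
  qed
qed

text \<open>The endpoints of \<open>J\<close> are the values of the two constant sequences.\<close>

lemma proj_in_J: "proj \<beta> \<alpha> \<omega> \<in> J \<beta> \<alpha>"
proof -
  have "- \<alpha> / (\<beta> - 1) \<le> proj \<beta> \<alpha> \<omega>"
    unfolding proj_def using beta_pos
    by (intro sums_le[OF _ sums_geometric summable_sums[OF summable_proj]] divide_right_mono) auto
  moreover have "proj \<beta> \<alpha> \<omega> \<le> (1 - \<alpha>) / (\<beta> - 1)"
    unfolding proj_def using beta_pos
    by (intro sums_le[OF _ summable_sums[OF summable_proj] sums_geometric] divide_right_mono) auto
  ultimately show ?thesis
    by (simp add: J_def)
qed

lemma proj_reflect: "proj \<beta> (2 - \<beta> - \<alpha>) (\<lambda>n. \<not> \<omega> n) = 1 - proj \<beta> \<alpha> \<omega>"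
proof -
  \<comment> \<open>The number 1 is written as the geometric series of
    \<open>(\<beta> - 1) / \<beta> ^ Suc k\<close>.\<close>
  have "(\<lambda>k. (\<beta> - 1) / \<beta> ^ Suc k - (of_bool (\<omega> k) - \<alpha>) / \<beta> ^ Suc k) sums
      ((\<beta> - 1) / (\<beta> - 1) - proj \<beta> \<alpha> \<omega>)"
    unfolding proj_def by (intro sums_diff sums_geometric summable_sums summable_proj)
  moreover have "(\<beta> - 1) / \<beta> ^ Suc k - (of_bool (\<omega> k) - \<alpha>) / \<beta> ^ Suc k
      = (of_bool (\<not> \<omega> k) - (2 - \<beta> - \<alpha>)) / \<beta> ^ Suc k" for k
    unfolding diff_divide_distrib[symmetric] by (simp add: of_bool_def)
  ultimately show ?thesis
    unfolding proj_def using beta_gt_1 by (simp add: sums_iff)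
qed

lemma is_orbit_proj: "is_orbit \<beta> \<alpha> \<omega> (\<lambda>n. proj \<beta> \<alpha> (suffix n \<omega>))"
  unfolding is_orbit_def
proof
  fix n
  have "proj \<beta> \<alpha> (suffix n \<omega>) =
      (\<Sum>k. (of_bool (suffix n \<omega> (Suc k)) - \<alpha>) / \<beta> ^ Suc (Suc k)) + (of_bool (\<omega> n) - \<alpha>) / \<beta>"
    unfolding proj_def using suminf_split_head[OF summable_proj[of "suffix n \<omega>"]] by simp
  moreover have "(\<Sum>k. (of_bool (suffix n \<omega> (Suc k)) - \<alpha>) / \<beta> ^ Suc (Suc k)) =
      proj \<beta> \<alpha> (suffix (Suc n) \<omega>) / \<beta>"
    unfolding proj_def using suminf_divide[OF summable_proj[of "suffix (Suc n) \<omega>"], of \<beta>]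
    by (simp add: ac_simps)
  ultimately have "proj \<beta> \<alpha> (suffix n \<omega>) =
      proj \<beta> \<alpha> (suffix (Suc n) \<omega>) / \<beta> + (of_bool (\<omega> n) - \<alpha>) / \<beta>"
    by (simp only:)
  then show "proj \<beta> \<alpha> (suffix (Suc n) \<omega>) = \<beta> * proj \<beta> \<alpha> (suffix n \<omega>) + \<alpha> - of_bool (\<omega> n)"
    using beta_pos by (simp only:) (simp add: field_simps)
qed

lemma proj_suffix_Suc:
  "proj \<beta> \<alpha> (suffix (Suc n) \<omega>) = \<beta> * proj \<beta> \<alpha> (suffix n \<omega>) + \<alpha> - of_bool (\<omega> n)"
  using is_orbit_step[OF is_orbit_proj] .

lemma proj_diff_T_minus:
  assumes "\<And>i. i < j \<Longrightarrow> \<omega> (n + i) = tau_minus \<beta> \<alpha> x i"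
  shows "proj \<beta> \<alpha> (suffix (n + j) \<omega>) - (T_minus \<beta> \<alpha> ^^ j) x = \<beta> ^ j * (proj \<beta> \<alpha> (suffix n \<omega>) - x)"
  using is_orbit_diff[OF is_orbit_shift[OF is_orbit_proj, of \<omega> n] is_orbit_T_minus] assms by simp

section \<open>Bounds on the tails of sequences that obey the kneading conditions\<close>

lemma T_minus_unit_interval:
  assumes "x \<in> {0..1}"
  shows "T_minus \<beta> \<alpha> x \<in> {0..1}"
proof -
  have "0 \<le> \<beta> * x" "\<beta> * x \<le> \<beta> * 1"
    using assms beta_pos by (simp_all del: mult_1_right)
  then show ?thesis
    using alpha_nonneg alpha_le by (auto simp: T_minus_def le_crit_iff)
qed

lemma T_minus_funpow_unit_interval: "x \<in> {0..1} \<Longrightarrow> (T_minus \<beta> \<alpha> ^^ n) x \<in> {0..1}"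
  by (induction n) (auto simp: T_minus_unit_interval simp del: atLeastAtMost_iff)

text \<open>
  If the bound 1 is exceeded, compare the tail with \<^term>\<open>tau_minus \<beta> \<alpha> 1\<close>. They cannot agree forever,
  as the map is expanding, and the first disagreement yields a later place where the bound is
  exceeded by \<open>\<beta>\<close> times as much. This contradicts the boundedness of \<^const>\<open>proj\<close>.
\<close>

lemma proj_le_1:
  assumes \<omega>: "obeys False (tau_minus \<beta> \<alpha> 1) \<omega>" and "\<not> \<omega> n"
  shows "proj \<beta> \<alpha> (suffix (Suc n) \<omega>) \<le> 1"
proof (rule ccontr)
  define e where "e = proj \<beta> \<alpha> (suffix (Suc n) \<omega>) - 1"
  assume "\<not> ?thesis"
  then have "e > 0"
    by (simp add: e_def)
  define B where "B = (1 - \<alpha>) / (\<beta> - 1)"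
  have B: "proj \<beta> \<alpha> \<omega>' \<le> B" for \<omega>'
    using proj_in_J[of \<omega>'] by (simp add: J_def B_def)
  have grow: "\<exists>n'. \<not> \<omega> n' \<and> \<beta> * (proj \<beta> \<alpha> (suffix (Suc n) \<omega>) - 1) \<le> proj \<beta> \<alpha> (suffix (Suc n') \<omega>) - 1"
    if n: "\<not> \<omega> n" "proj \<beta> \<alpha> (suffix (Suc n) \<omega>) > 1" for n
  proof -
    define \<delta> where "\<delta> = proj \<beta> \<alpha> (suffix (Suc n) \<omega>) - 1"
    have "\<delta> > 0"
      using n by (simp add: \<delta>_def)
    have "\<exists>j. \<omega> (Suc n + j) \<noteq> tau_minus \<beta> \<alpha> 1 j"
    proof (rule ccontr)
      assume "\<not> ?thesis"
      then have diff: "proj \<beta> \<alpha> (suffix (Suc n + j) \<omega>) - (T_minus \<beta> \<alpha> ^^ j) 1 = \<beta> ^ j * \<delta>" for j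
        unfolding \<delta>_def by (intro proj_diff_T_minus) simp
      obtain j where "\<beta> ^ j > B / \<delta>"
        using real_arch_pow[OF beta_gt_1] by blast
      then have "\<beta> ^ j * \<delta> > B"
        using \<open>\<delta> > 0\<close> by (simp add: pos_divide_less_eq)
      then show False
        using diff[of j] B[of "suffix (Suc n + j) \<omega>"] T_minus_funpow_unit_interval[of 1 j] by simp
    qed
    then obtain j where j: "\<omega> (Suc n + j) \<noteq> tau_minus \<beta> \<alpha> 1 j"
      and agree: "\<And>i. i < j \<Longrightarrow> \<omega> (Suc n + i) = tau_minus \<beta> \<alpha> 1 i"
      using exists_least_iff[of "\<lambda>j. \<omega> (Suc n + j) \<noteq> tau_minus \<beta> \<alpha> 1 j"] by blast
    \<comment> \<open>The condition forbids a 1 against a 0 of the kneading sequence, so the first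
      disagreement is a 0 against a 1. There the orbit of 1 is right of the critical point, and the
      tail, lying further right, overshoots 1 at the next step.\<close>
    have "\<not> \<omega> (Suc n + j)"
      using obeysD[OF \<omega>, of n j] n agree j by blast
    with j have "tau_minus \<beta> \<alpha> 1 j"
      by simp
    then have "1 < \<beta> * (T_minus \<beta> \<alpha> ^^ j) 1 + \<alpha>"
      by (simp add: tau_minus_iff)
    moreover have "proj \<beta> \<alpha> (suffix (Suc n + j) \<omega>) - (T_minus \<beta> \<alpha> ^^ j) 1 = \<beta> ^ j * \<delta>"
      unfolding \<delta>_def by (intro proj_diff_T_minus agree)
    moreover have "proj \<beta> \<alpha> (suffix (Suc (Suc n + j)) \<omega>) = \<beta> * proj \<beta> \<alpha> (suffix (Suc n + j) \<omega>) + \<alpha>"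
      using proj_suffix_Suc[of "Suc n + j" \<omega>] \<open>\<not> \<omega> (Suc n + j)\<close> by simp
    moreover have "\<beta> * \<delta> \<le> \<beta> * (\<beta> ^ j * \<delta>)"
      using beta_gt_1 \<open>\<delta> > 0\<close> by simp
    ultimately have "\<beta> * \<delta> \<le> proj \<beta> \<alpha> (suffix (Suc (Suc n + j)) \<omega>) - 1"
      by (simp add: algebra_simps)
    then show ?thesis
      using \<open>\<not> \<omega> (Suc n + j)\<close> \<delta>_def by blast
  qed
  have "\<exists>n'. \<not> \<omega> n' \<and> \<beta> ^ q * e \<le> proj \<beta> \<alpha> (suffix (Suc n') \<omega>) - 1" for q
  proof (induction q)
    case 0
    then show ?case
      using \<open>\<not> \<omega> n\<close> by (auto simp: e_def simp del: suffix_nth)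
  next
    case (Suc q)
    then obtain n' where n': "\<not> \<omega> n'" "\<beta> ^ q * e \<le> proj \<beta> \<alpha> (suffix (Suc n') \<omega>) - 1"
      by blast
    moreover have "\<beta> ^ q * e > 0"
      using beta_pos \<open>e > 0\<close> by simp
    ultimately obtain n'' where "\<not> \<omega> n''"
      "\<beta> * (proj \<beta> \<alpha> (suffix (Suc n') \<omega>) - 1) \<le> proj \<beta> \<alpha> (suffix (Suc n'') \<omega>) - 1"
      using grow[of n'] by force
    moreover have "\<beta> ^ Suc q * e \<le> \<beta> * (proj \<beta> \<alpha> (suffix (Suc n') \<omega>) - 1)"
      using n'(2) beta_pos by (simp add: mult.assoc)
    ultimately show ?case
      using order_trans by blast
  qed
  note escape = this
  obtain q where "\<beta> ^ q > B / e"
    using real_arch_pow[OF beta_gt_1] by blast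
  then have "\<beta> ^ q * e > B"
    using \<open>e > 0\<close> by (simp add: pos_divide_less_eq)
  moreover obtain n' where "\<beta> ^ q * e \<le> proj \<beta> \<alpha> (suffix (Suc n') \<omega>) - 1"
    using escape by blast
  ultimately show False
    using B[of "suffix (Suc n') \<omega>"] by linarith
qed

text \<open>A tail of value exactly 1 after a 0 must equal the kneading sequence: a larger digit
  violates \<open>obeys\<close>, a smaller one violates \<open>proj_le_1\<close>. From then on the
  points follow \<open>T_minus\<close>, which takes a 1 only strictly right of the critical
  point.\<close>

lemma proj_pos_after_proj_eq_1:
  assumes \<omega>: "obeys False (tau_minus \<beta> \<alpha> 1) \<omega>"
    and "\<not> \<omega> n" "proj \<beta> \<alpha> (suffix (Suc n) \<omega>) = 1" "n < k" "\<omega> k"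
  shows "0 < proj \<beta> \<alpha> (suffix (Suc k) \<omega>)"
proof -
  have proj_eq: "proj \<beta> \<alpha> (suffix (Suc n + j) \<omega>) = (T_minus \<beta> \<alpha> ^^ j) 1"
    if "\<And>i. i < j \<Longrightarrow> \<omega> (Suc n + i) = tau_minus \<beta> \<alpha> 1 i" for j
    using proj_diff_T_minus[where j = j and \<omega> = \<omega> and n = "Suc n" and x = 1] that assms(3) by simp
  have follow: "\<omega> (Suc n + j) = tau_minus \<beta> \<alpha> 1 j" for j
  proof (induction j rule: less_induct)
    case (less j)
    have "\<not> \<omega> (Suc n + j)" if "\<not> tau_minus \<beta> \<alpha> 1 j"
      using obeysD[OF \<omega>, of n j] less assms(2) that by blast
    moreover have "\<omega> (Suc n + j)" if "tau_minus \<beta> \<alpha> 1 j"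
    proof (rule ccontr)
      assume "\<not> \<omega> (Suc n + j)"
      then have "\<beta> * (T_minus \<beta> \<alpha> ^^ j) 1 + \<alpha> \<le> 1"
        using proj_le_1[OF \<omega>, of "Suc n + j"] proj_suffix_Suc[of "Suc n + j" \<omega>]
          proj_eq[OF less] by simp
      then show False
        using that by (simp add: tau_minus_iff)
    qed
    ultimately show ?case
      by blast
  qed
  obtain j where k: "k = Suc n + j"
    using less_imp_Suc_add[OF \<open>n < k\<close>] by auto
  have "1 < \<beta> * (T_minus \<beta> \<alpha> ^^ j) 1 + \<alpha>"
    using \<open>\<omega> k\<close> follow[of j] by (simp add: k tau_minus_iff)
  then show ?thesis
    using proj_suffix_Suc[of k \<omega>] \<open>\<omega> k\<close> proj_eq[OF follow, of j] by (simp add: k)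
qed

lemma proj_nonneg:
  assumes "obeys True (tau_plus \<beta> \<alpha> 0) \<omega>" "\<omega> n"
  shows "0 \<le> proj \<beta> \<alpha> (suffix (Suc n) \<omega>)"
  using intermediate_beta.proj_le_1[OF reflected, of "\<lambda>n. \<not> \<omega> n" n] assms
  by (simp add: obeys_reflect suffix_def proj_reflect)

lemma proj_less_1_after_proj_eq_0:
  assumes "obeys True (tau_plus \<beta> \<alpha> 0) \<omega>"
    and "\<omega> n" "proj \<beta> \<alpha> (suffix (Suc n) \<omega>) = 0" "n < k" "\<not> \<omega> k"
  shows "proj \<beta> \<alpha> (suffix (Suc k) \<omega>) < 1"
  using intermediate_beta.proj_pos_after_proj_eq_1[OF reflected, of "\<lambda>n. \<not> \<omega> n" n k] assms
  by (simp add: obeys_reflect suffix_def proj_reflect)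

section \<open>Recovering a sequence from its projection\<close>

lemma tau_plus_proj:
  assumes lt: "\<And>n. \<not> \<omega> n \<Longrightarrow> proj \<beta> \<alpha> (suffix (Suc n) \<omega>) < 1"
    and ge: "\<And>n. \<omega> n \<Longrightarrow> 0 \<le> proj \<beta> \<alpha> (suffix (Suc n) \<omega>)"
  shows "tau_plus \<beta> \<alpha> (proj \<beta> \<alpha> \<omega>) = \<omega>"
proof -
  have digit: "1 \<le> \<beta> * proj \<beta> \<alpha> (suffix n \<omega>) + \<alpha> \<longleftrightarrow> \<omega> n" for n
    using proj_suffix_Suc[of n \<omega>] lt[of n] ge[of n] by (cases "\<omega> n") auto
  have "(T_plus \<beta> \<alpha> ^^ n) (proj \<beta> \<alpha> \<omega>) = proj \<beta> \<alpha> (suffix n \<omega>)" for n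
  proof (induction n)
    case (Suc n)
    then show ?case
      using proj_suffix_Suc[of n \<omega>] digit[of n]
      by (auto simp: T_plus_def less_crit_iff simp del: suffix_nth)
  qed simp
  then show ?thesis
    by (auto simp: tau_plus_iff digit)
qed

lemma tau_minus_proj:
  assumes "\<And>n. \<not> \<omega> n \<Longrightarrow> proj \<beta> \<alpha> (suffix (Suc n) \<omega>) \<le> 1"
    and "\<And>n. \<omega> n \<Longrightarrow> 0 < proj \<beta> \<alpha> (suffix (Suc n) \<omega>)"
  shows "tau_minus \<beta> \<alpha> (proj \<beta> \<alpha> \<omega>) = \<omega>"
  using intermediate_beta.tau_plus_proj[OF reflected, of "\<lambda>n. \<not> \<omega> n"] assms
  by (simp add: suffix_def proj_reflect tau_plus_reflect fun_eq_iff)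

text \<open>Obeying sequences satisfy the weak bounds on tails. One that is neither kind of
  expansion attains both the bound 1 after some 0 and the bound 0 after some 1; whichever comes
  first excludes the other.\<close>

lemma Omega_eq:
  "Omega \<beta> \<alpha> = {\<omega>. obeys False (tau_minus \<beta> \<alpha> 1) \<omega> \<and> obeys True (tau_plus \<beta> \<alpha> 0) \<omega>}"
proof (intro equalityI subsetI)
  fix \<omega>
  assume "\<omega> \<in> Omega \<beta> \<alpha>"
  then show "\<omega> \<in> {\<omega>. obeys False (tau_minus \<beta> \<alpha> 1) \<omega> \<and> obeys True (tau_plus \<beta> \<alpha> 0) \<omega>}"
    by (auto simp: Omega_def tau_obeys_tau_minus_1 tau_obeys_tau_plus_0)
next
  fix \<omega>
  assume "\<omega> \<in> {\<omega>. obeys False (tau_minus \<beta> \<alpha> 1) \<omega> \<and> obeys True (tau_plus \<beta> \<alpha> 0) \<omega>}"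
  then have \<omega>: "obeys False (tau_minus \<beta> \<alpha> 1) \<omega>" "obeys True (tau_plus \<beta> \<alpha> 0) \<omega>"
    by auto
  show "\<omega> \<in> Omega \<beta> \<alpha>"
  proof (rule ccontr)
    assume "\<omega> \<notin> Omega \<beta> \<alpha>"
    then have "tau_plus \<beta> \<alpha> (proj \<beta> \<alpha> \<omega>) \<noteq> \<omega>" "tau_minus \<beta> \<alpha> (proj \<beta> \<alpha> \<omega>) \<noteq> \<omega>"
      unfolding Omega_def using proj_in_J[of \<omega>] by (metis UnI1 UnI2 imageI)+
    then obtain n k where n: "\<not> \<omega> n" "\<not> proj \<beta> \<alpha> (suffix (Suc n) \<omega>) < 1"
      and k: "\<omega> k" "\<not> 0 < proj \<beta> \<alpha> (suffix (Suc k) \<omega>)"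
      using tau_plus_proj[of \<omega>] tau_minus_proj[of \<omega>] proj_le_1[OF \<omega>(1)] proj_nonneg[OF \<omega>(2)]
      by metis
    have "proj \<beta> \<alpha> (suffix (Suc n) \<omega>) = 1" "proj \<beta> \<alpha> (suffix (Suc k) \<omega>) = 0"
      using n k proj_le_1[OF \<omega>(1), of n] proj_nonneg[OF \<omega>(2), of k] by auto
    then show False
      using n k proj_pos_after_proj_eq_1[OF \<omega>(1), of n k] proj_less_1_after_proj_eq_0[OF \<omega>(2), of k n]
      by (metis linorder_neqE_nat)
  qed
qed

text \<open>One step after hitting the critical point each orbit is back at its start, so the
  kneading sequences are periodic. At that point \<open>T_plus\<close> takes a 1 and
  \<open>T_minus\<close> a 0, the required last digits of the periods.\<close>

lemma subshift_of_finite_type_Omega: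
  assumes n: "(T_plus \<beta> \<alpha> ^^ n) 0 = crit \<beta> \<alpha>" and k: "(T_minus \<beta> \<alpha> ^^ k) 1 = crit \<beta> \<alpha>"
  shows "subshift_of_finite_type (Omega \<beta> \<alpha>)"
proof -
  have crit: "\<beta> * crit \<beta> \<alpha> + \<alpha> = 1"
    using beta_pos by (simp add: crit_def)
  have "(T_plus \<beta> \<alpha> ^^ Suc n) 0 = 0" "(T_minus \<beta> \<alpha> ^^ Suc k) 1 = 1"
    using n k crit by (simp_all add: T_plus_def T_minus_def)
  then have "tau_plus \<beta> \<alpha> 0 (i + Suc n) = tau_plus \<beta> \<alpha> 0 i"
    "tau_minus \<beta> \<alpha> 1 (i + Suc k) = tau_minus \<beta> \<alpha> 1 i" for i
    unfolding tau_plus_def tau_minus_def funpow_add by simp_all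
  moreover have "tau_plus \<beta> \<alpha> 0 n" "\<not> tau_minus \<beta> \<alpha> 1 k"
    using n k by (simp_all add: tau_plus_def tau_minus_def)
  ultimately show ?thesis
    unfolding Omega_eq by (intro subshift_of_finite_type_obeys[of "Suc k" _ "Suc n"]) auto
qed

end

section \<open>Multinacci bases\<close>

text \<open>Divided by \<open>x ^ m\<close>, the equation equates 1 with a sum of negative powers,
  which strictly decreases in \<open>x\<close>. The proof compares the terms after
  cross-multiplication.\<close>

lemma multinacci_root_unique:
  fixes x y :: real
  assumes "0 < x" "x < y" "0 < m" "x ^ m = (\<Sum>i<m. x ^ i)"
  shows "y ^ m \<noteq> (\<Sum>i<m. y ^ i)"
proof
  assume y: "y ^ m = (\<Sum>i<m. y ^ i)"
  have "y ^ i * x ^ m < x ^ i * y ^ m" if "i < m" for i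
  proof -
    have "x ^ (m - i) < y ^ (m - i)"
      using assms that by (intro power_strict_mono) auto
    then have "(x * y) ^ i * x ^ (m - i) < (x * y) ^ i * y ^ (m - i)"
      using assms by simp
    then show ?thesis
      using that power_add[of x i "m - i"] power_add[of y i "m - i"]
      by (simp add: power_mult_distrib mult_ac)
  qed
  then have "(\<Sum>i<m. y ^ i * x ^ m) < (\<Sum>i<m. x ^ i * y ^ m)"
    using \<open>0 < m\<close> by (intro sum_strict_mono) auto
  then show False
    unfolding sum_distrib_right[symmetric] y[symmetric] assms(4)[symmetric]
    by (simp add: mult.commute)
qed

lemma multinacci:
  assumes "m \<ge> 2"
  shows "1 < multinacci m" "multinacci m < 2" "multinacci m ^ m = (\<Sum>i<m. multinacci m ^ i)"
proof -
  define f :: "real \<Rightarrow> real" where "f x = x ^ m - (\<Sum>i<m. x ^ i)" for x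
  have "f 1 < 0"
    using assms by (simp add: f_def)
  have "f 2 > 0"
    by (simp add: f_def geometric_sum)
  obtain x where x: "1 \<le> x" "x \<le> 2" "f x = 0"
  proof -
    have "continuous_on {1..2} f"
      unfolding f_def by (intro continuous_intros)
    then show ?thesis
      using IVT'[of f 1 0 2] \<open>f 1 < 0\<close> \<open>f 2 > 0\<close> that by auto
  qed
  with \<open>f 1 < 0\<close> \<open>f 2 > 0\<close> have "x \<noteq> 1" "x \<noteq> 2"
    by auto
  with x have x: "1 < x \<and> x < 2 \<and> x ^ m = (\<Sum>i<m. x ^ i)"
    by (simp add: f_def)
  moreover have "y = x" if "1 < y \<and> y < 2 \<and> y ^ m = (\<Sum>i<m. y ^ i)" for y
    using multinacci_root_unique[of x y m] multinacci_root_unique[of y x m] that x assms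
    by (cases x y rule: linorder_cases) auto
  ultimately have "1 < multinacci m \<and> multinacci m < 2 \<and>
      multinacci m ^ m = (\<Sum>i<m. multinacci m ^ i)"
    unfolding multinacci_def by (rule theI[of _ x])
  then show "1 < multinacci m" "multinacci m < 2" "multinacci m ^ m = (\<Sum>i<m. multinacci m ^ i)"
    by auto
qed

lemma funpow_fixpoint: "f x = x \<Longrightarrow> (f ^^ n) x = x"
  by (induction n) simp_all

context intermediate_beta
begin

lemma T_plus_funpow_unit_interval:
  assumes "x \<in> {0..1}"
  shows "(T_plus \<beta> \<alpha> ^^ n) x \<in> {0..1}"
proof -
  interpret r: intermediate_beta \<beta> "2 - \<beta> - \<alpha>"
    by (rule reflected)
  show ?thesis
    using r.T_minus_funpow_unit_interval[of "1 - x" n] r.T_plus_funpow_reflect[of n "1 - x"] assms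
    by simp
qed

text \<open>
  Before step \<open>m - 1\<close> the distance \<open>d\<close> of the two orbits is more than \<open>1 / \<beta>\<close>, so the two points are
  on different sides of the critical point, since otherwise their images would have a distance of
  more than 1. Hence the distance evolves by \<open>d \<mapsto> \<beta> d - 1\<close>, from 1 to \<open>1 / \<beta>\<close>.
\<close>

lemma orbits_meet:
  assumes "0 < m" and root: "\<beta> ^ m = (\<Sum>i<m. \<beta> ^ i)"
  shows "(T_plus \<beta> \<alpha> ^^ m) 0 = (T_minus \<beta> \<alpha> ^^ m) 1
    \<or> (T_plus \<beta> \<alpha> ^^ m) 0 = 0 \<and> (T_minus \<beta> \<alpha> ^^ m) 1 = 1"
proof -
  define d where "d k = \<beta> ^ k - (\<Sum>i<k. \<beta> ^ i)" for k
  define x where "x k = (T_plus \<beta> \<alpha> ^^ k) 0" for k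
  define y where "y k = (T_minus \<beta> \<alpha> ^^ k) 1" for k
  have x01: "0 \<le> x k" "x k \<le> 1" and y01: "0 \<le> y k" "y k \<le> 1" for k
    using T_plus_funpow_unit_interval[of 0 k] T_minus_funpow_unit_interval[of 1 k]
    by (simp_all add: x_def y_def)
  have x_Suc: "x (Suc k) = \<beta> * x k + \<alpha> - of_bool (1 \<le> \<beta> * x k + \<alpha>)" for k
    using T_plus_funpow_Suc[of k \<beta> \<alpha> 0] by (simp add: x_def tau_plus_iff)
  have y_Suc: "y (Suc k) = \<beta> * y k + \<alpha> - of_bool (1 < \<beta> * y k + \<alpha>)" for k
    using T_minus_funpow_Suc[of k \<beta> \<alpha> 1] by (simp add: y_def tau_minus_iff)
  have d_Suc: "d (Suc k) = \<beta> * d k - 1" for k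
    unfolding d_def sum.lessThan_Suc_shift by (simp add: sum_distrib_left algebra_simps)
  have "d m = 0"
    using root by (simp add: d_def)
  \<comment> \<open>Downward induction from \<open>d m = 0\<close>, using
    \<open>\<beta> * d k = d (Suc k) + 1\<close>.\<close>
  have d_pos: "0 < d k" if "k < m" for k
    using that
  proof (induction k rule: strict_inc_induct)
    case (base k)
    then have "0 < \<beta> * d k"
      using d_Suc[of k] \<open>d m = 0\<close> by simp
    then show ?case
      using beta_pos by (simp add: zero_less_mult_iff)
  next
    case (step k)
    then have "0 < \<beta> * d k"
      using d_Suc[of k] by simp
    then show ?case
      using beta_pos by (simp add: zero_less_mult_iff)
  qed
  \<comment> \<open>The alternatives are equal digits, or 0 for \<open>x\<close> and 1 for
    \<open>y\<close>; the reverse is impossible since \<open>x k < y k\<close>.\<close>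
  have step: "y (Suc k) - x (Suc k) = \<beta> * d k \<or> y (Suc k) - x (Suc k) = d (Suc k)"
    if "k < m" "y k - x k = d k" for k
  proof -
    have "\<beta> * y k - \<beta> * x k = \<beta> * d k"
      using that by (simp flip: right_diff_distrib)
    moreover have "0 < \<beta> * d k"
      using d_pos[OF \<open>k < m\<close>] beta_pos by simp
    ultimately show ?thesis
      unfolding x_Suc y_Suc d_Suc by (auto simp: of_bool_def)
  qed
  have dist: "y k - x k = d k" if "k < m" for k
    using that
  proof (induction k)
    case 0
    then show ?case
      by (simp add: x_def y_def d_def)
  next
    case (Suc k)
    have "\<beta> * d k > 1"
      using d_Suc[of k] d_pos[OF Suc.prems] by simp
    then show ?case
      using step[of k] Suc x01[of "Suc k"] y01[of "Suc k"] by force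
  qed
  obtain k where m: "m = Suc k"
    using \<open>0 < m\<close> gr0_conv_Suc by blast
  \<comment> \<open>Here \<open>\<beta> * d k = 1\<close> because \<open>d m = 0\<close>. A distance
    of 1 inside the unit interval forces the endpoints.\<close>
  have "y m - x m = 1 \<or> y m - x m = 0"
    using step[of k] dist[of k] d_Suc[of k] \<open>d m = 0\<close> by (auto simp: m)
  then show ?thesis
    unfolding x_def[symmetric] y_def[symmetric] using x01[of m] y01[of m] by auto
qed

lemma T_plus_eq_T_minus: "x \<noteq> crit \<beta> \<alpha> \<Longrightarrow> T_plus \<beta> \<alpha> x = T_minus \<beta> \<alpha> x"
  by (auto simp: T_plus_def T_minus_def)

text \<open>If the orbits merge, the periodic orbit of 0 hits the critical point again after
  merging, and until then both maps act alike. If the orbit of 1 returns to 1, it does so through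
  the critical point: the right branch reaches 1 only from beyond 1, as \<alpha> < 2 -
  \<beta>.\<close>

lemma T_minus_hits_crit:
  assumes "0 < m" "\<beta> ^ m = (\<Sum>i<m. \<beta> ^ i)" "\<alpha> < 2 - \<beta>" and n: "(T_plus \<beta> \<alpha> ^^ n) 0 = crit \<beta> \<alpha>"
  shows "\<exists>k. (T_minus \<beta> \<alpha> ^^ k) 1 = crit \<beta> \<alpha>"
proof -
  have crit: "\<beta> * crit \<beta> \<alpha> + \<alpha> = 1"
    using beta_pos by (simp add: crit_def)
  consider "(T_plus \<beta> \<alpha> ^^ m) 0 = (T_minus \<beta> \<alpha> ^^ m) 1" | "(T_minus \<beta> \<alpha> ^^ m) 1 = 1"
    using orbits_meet[OF assms(1,2)] by blast
  then show ?thesis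
  proof cases
    case 1
    have "(T_plus \<beta> \<alpha> ^^ Suc n) 0 = 0"
      using n crit by (simp add: T_plus_def)
    then have "((T_plus \<beta> \<alpha> ^^ Suc n) ^^ m) 0 = 0"
      by (rule funpow_fixpoint)
    then have "(T_plus \<beta> \<alpha> ^^ (m * Suc n)) 0 = 0"
      by (simp only: funpow_mult mult.commute)
    \<comment> \<open>Adding \<open>m\<close> periods moves the hit past time
      \<open>m\<close>.\<close>
    then have "(T_plus \<beta> \<alpha> ^^ (n + m * Suc n)) 0 = crit \<beta> \<alpha>"
      using n by (simp add: funpow_add)
    moreover have "m \<le> n + m * Suc n"
      by simp
    ultimately have "\<exists>i. (T_plus \<beta> \<alpha> ^^ (m + i)) 0 = crit \<beta> \<alpha>"
      by (metis le_Suc_ex)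
    then obtain i where i: "(T_plus \<beta> \<alpha> ^^ (m + i)) 0 = crit \<beta> \<alpha>"
      and first: "\<And>j. j < i \<Longrightarrow> (T_plus \<beta> \<alpha> ^^ (m + j)) 0 \<noteq> crit \<beta> \<alpha>"
      using exists_least_iff[of "\<lambda>i. (T_plus \<beta> \<alpha> ^^ (m + i)) 0 = crit \<beta> \<alpha>"] by blast
    have "j \<le> i \<Longrightarrow> (T_plus \<beta> \<alpha> ^^ (m + j)) 0 = (T_minus \<beta> \<alpha> ^^ (m + j)) 1" for j
    proof (induction j)
      case (Suc j)
      then show ?case
        using first[of j] T_plus_eq_T_minus by simp
    qed (use 1 in simp)
    with i show ?thesis
      by (metis order_refl)
  next
    case 2
    obtain k where m: "m = Suc k"
      using \<open>0 < m\<close> gr0_conv_Suc by blast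
    define y where "y = (T_minus \<beta> \<alpha> ^^ k) 1"
    have "y \<le> 1"
      using T_minus_funpow_unit_interval[of 1 k] by (simp add: y_def)
    then have "\<beta> * y \<le> \<beta>"
      using beta_pos by simp
    moreover have "T_minus \<beta> \<alpha> y = 1"
      using 2 by (simp add: m y_def)
    ultimately have "\<beta> * y + \<alpha> = \<beta> * crit \<beta> \<alpha> + \<alpha>"
      unfolding crit using \<open>\<alpha> < 2 - \<beta>\<close> by (auto simp: T_minus_def split: if_splits)
    then have "y = crit \<beta> \<alpha>"
      using beta_pos by simp
    then show ?thesis
      unfolding y_def by blast
  qed
qed

end

text \<open>
  If the orbit of 0 avoids the critical point for all parameters in an interval, then by continuity
  its itinerary does not depend on the parameter there, and the \<open>n\<close>-th iterate is an affine function
  of the parameter with slope \<open>1 + \<beta> + \<dots> + \<beta>\<^sup>n\<^sup>-\<^sup>1\<close>; but it has to stay in \<open>[0, 1]\<close>.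
\<close>

lemma exists_T_plus_hits_crit:
  assumes \<beta>: "1 < \<beta>" "\<beta> < 2" and ab: "0 \<le> a" "a < b" "b \<le> 2 - \<beta>"
  shows "\<exists>\<alpha>\<in>{a<..<b}. \<exists>n. (T_plus \<beta> \<alpha> ^^ n) 0 = crit \<beta> \<alpha>"
proof (rule ccontr)
  assume "\<not> ?thesis"
  then have avoid: "(T_plus \<beta> \<alpha> ^^ n) 0 \<noteq> crit \<beta> \<alpha>" if "\<alpha> \<in> {a<..<b}" for \<alpha> n
    using that by blast
  have loc: "intermediate_beta \<beta> \<alpha>" if "\<alpha> \<in> {a<..<b}" for \<alpha>
    using that assms by unfold_locales auto
  define S where "S n = (\<Sum>i<n. \<beta> ^ i)" for n
  have S_Suc: "S (Suc n) = \<beta> * S n + 1" for n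
    unfolding S_def sum.lessThan_Suc_shift by (simp add: sum_distrib_left)
  have S_ge: "real n \<le> S n" for n
    unfolding S_def using sum_mono[of "{..<n}" "\<lambda>_. 1" "\<lambda>i. \<beta> ^ i"] \<beta> by simp
  have "\<exists>c. \<forall>\<alpha>\<in>{a<..<b}. (T_plus \<beta> \<alpha> ^^ n) 0 = S n * \<alpha> + c" for n
  proof (induction n)
    case 0
    show ?case
      by (auto simp: S_def)
  next
    case (Suc n)
    then obtain c where c: "\<And>\<alpha>. \<alpha> \<in> {a<..<b} \<Longrightarrow> (T_plus \<beta> \<alpha> ^^ n) 0 = S n * \<alpha> + c"
      by blast
    define g where "g \<alpha> = S (Suc n) * \<alpha> + \<beta> * c" for \<alpha>
    have g: "\<beta> * (T_plus \<beta> \<alpha> ^^ n) 0 + \<alpha> = g \<alpha>" if "\<alpha> \<in> {a<..<b}" for \<alpha>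
      using c[OF that] by (simp add: g_def S_Suc algebra_simps)
    have step: "(T_plus \<beta> \<alpha> ^^ Suc n) 0 = g \<alpha> - of_bool (1 \<le> g \<alpha>)" if "\<alpha> \<in> {a<..<b}" for \<alpha>
      using T_plus_funpow_Suc[of n \<beta> \<alpha> 0] g[OF that]
      by (simp add: intermediate_beta.tau_plus_iff[OF loc[OF that]])
    have g_neq: "g \<alpha> \<noteq> 1" if "\<alpha> \<in> {a<..<b}" for \<alpha>
      using avoid[OF that, of n] g[OF that] \<beta> by (auto simp: crit_def field_simps)
    have "S (Suc n) > 0"
      using S_ge[of "Suc n"] by simp
    have "1 \<le> g \<alpha>'" if \<alpha>: "\<alpha> \<in> {a<..<b}" "\<alpha>' \<in> {a<..<b}" "1 \<le> g \<alpha>" for \<alpha> \<alpha>'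
    proof (rule ccontr)
      assume "\<not> 1 \<le> g \<alpha>'"
      \<comment> \<open>The parameter where the affine function \<open>g\<close> crosses 1; there
        the orbit would hit the critical point.\<close>
      define t where "t = (1 - \<beta> * c) / S (Suc n)"
      have "g t = 1"
        using \<open>S (Suc n) > 0\<close> by (simp add: g_def t_def)
      moreover have "\<alpha>' < t" "t \<le> \<alpha>"
        using \<open>S (Suc n) > 0\<close> \<open>\<not> 1 \<le> g \<alpha>'\<close> \<open>1 \<le> g \<alpha>\<close>
        by (simp_all add: g_def t_def field_simps)
      ultimately show False
        using g_neq[of t] \<alpha> by auto
    qed
    then have "(\<forall>\<alpha>\<in>{a<..<b}. 1 \<le> g \<alpha>) \<or> (\<forall>\<alpha>\<in>{a<..<b}. \<not> 1 \<le> g \<alpha>)"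
      by blast
    then show ?case
    proof
      assume "\<forall>\<alpha>\<in>{a<..<b}. 1 \<le> g \<alpha>"
      then show ?thesis
        using step by (intro exI[of _ "\<beta> * c - 1"]) (simp add: g_def del: funpow.simps)
    next
      assume "\<forall>\<alpha>\<in>{a<..<b}. \<not> 1 \<le> g \<alpha>"
      then show ?thesis
        using step by (intro exI[of _ "\<beta> * c"]) (simp add: g_def del: funpow.simps)
    qed
  qed
  note affine = this
  \<comment> \<open>Two interior points are needed, as the affine formula is only known on the open
    interval.\<close>
  define x where "x = (2 * a + b) / 3"
  define y where "y = (a + 2 * b) / 3"
  have xy: "x \<in> {a<..<b}" "y \<in> {a<..<b}" "x < y"
    using ab by (auto simp: x_def y_def)
  obtain n where n: "1 < real n * (y - x)"
    using reals_Archimedean3[of "y - x"] xy by auto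
  obtain c where c: "\<forall>\<alpha>\<in>{a<..<b}. (T_plus \<beta> \<alpha> ^^ n) 0 = S n * \<alpha> + c"
    using affine by blast
  have "real n * (y - x) \<le> S n * (y - x)"
    using S_ge[of n] xy by (intro mult_right_mono) auto
  also have "\<dots> = (T_plus \<beta> y ^^ n) 0 - (T_plus \<beta> x ^^ n) 0"
    using c xy by (simp add: algebra_simps)
  also have "\<dots> \<le> 1"
    using intermediate_beta.T_plus_funpow_unit_interval[OF loc[OF xy(1)], of 0 n]
      intermediate_beta.T_plus_funpow_unit_interval[OF loc[OF xy(2)], of 0 n] by simp
  finally show False
    using n by simp
qed

section \<open>Density in the fibre over a multinacci base\<close>

theorem theorem1p1:
  fixes m :: nat
  assumes "m \<ge> 2"
  shows "top_of_set (Delta (multinacci m)) closure_of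
           {(\<beta>, \<alpha>) \<in> Delta (multinacci m). subshift_of_finite_type (Omega \<beta> \<alpha>)}
         = Delta (multinacci m)"
proof (intro equalityI subsetI)
  fix z
  assume "z \<in> top_of_set (Delta (multinacci m)) closure_of
    {(\<beta>, \<alpha>) \<in> Delta (multinacci m). subshift_of_finite_type (Omega \<beta> \<alpha>)}"
  then show "z \<in> Delta (multinacci m)"
    by (simp add: in_closure_of)
next
  define \<beta> where "\<beta> = multinacci m"
  have \<beta>: "1 < \<beta>" "\<beta> < 2" "\<beta> ^ m = (\<Sum>i<m. \<beta> ^ i)"
    using multinacci[OF assms] by (simp_all add: \<beta>_def)
  fix z
  assume "z \<in> Delta (multinacci m)"
  then obtain \<alpha>\<^sub>0 where z: "z = (\<beta>, \<alpha>\<^sub>0)" and \<alpha>\<^sub>0: "0 \<le> \<alpha>\<^sub>0" "\<alpha>\<^sub>0 \<le> 2 - \<beta>"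
    by (auto simp: Delta_def \<beta>_def)
  have "\<exists>w. w \<in> {(\<gamma>, \<alpha>) \<in> Delta \<beta>. subshift_of_finite_type (Omega \<gamma> \<alpha>)} \<and> w \<in> V"
    if zV: "z \<in> V" and V: "openin (top_of_set (Delta \<beta>)) V" for V
  proof -
    obtain U where U: "open U" "V = Delta \<beta> \<inter> U"
      using V by (auto simp: openin_open)
    with zV z obtain \<epsilon> where "\<epsilon> > 0" and ball: "ball (\<beta>, \<alpha>\<^sub>0) \<epsilon> \<subseteq> U"
      by (auto elim: openE)
    \<comment> \<open>The neighbourhood is clipped to the fibre. Taking \<alpha> in the open
      interval also ensures \<alpha> < 2 - \<beta>, which \<open>T_minus_hits_crit\<close>
      requires.\<close>
    have "max 0 (\<alpha>\<^sub>0 - \<epsilon>) < min (2 - \<beta>) (\<alpha>\<^sub>0 + \<epsilon>)"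
      using \<beta> \<alpha>\<^sub>0 \<open>\<epsilon> > 0\<close> by auto
    then obtain \<alpha> n where \<alpha>: "max 0 (\<alpha>\<^sub>0 - \<epsilon>) < \<alpha>" "\<alpha> < min (2 - \<beta>) (\<alpha>\<^sub>0 + \<epsilon>)"
      and n: "(T_plus \<beta> \<alpha> ^^ n) 0 = crit \<beta> \<alpha>"
      using exists_T_plus_hits_crit[of \<beta> "max 0 (\<alpha>\<^sub>0 - \<epsilon>)" "min (2 - \<beta>) (\<alpha>\<^sub>0 + \<epsilon>)"] \<beta>
      by auto
    interpret intermediate_beta \<beta> \<alpha>
      using \<beta> \<alpha> by unfold_locales auto
    obtain k where "(T_minus \<beta> \<alpha> ^^ k) 1 = crit \<beta> \<alpha>"
      using T_minus_hits_crit[OF _ \<beta>(3) _ n] \<alpha> assms by auto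
    then have "subshift_of_finite_type (Omega \<beta> \<alpha>)"
      using subshift_of_finite_type_Omega n by blast
    moreover have "(\<beta>, \<alpha>) \<in> Delta \<beta>"
      using \<alpha> by (simp add: Delta_def)
    moreover have "(\<beta>, \<alpha>) \<in> U"
      using \<alpha> by (intro subsetD[OF ball]) (auto simp: dist_Pair_Pair dist_real_def)
    ultimately show ?thesis
      using U by blast
  qed
  then show "z \<in> top_of_set (Delta (multinacci m)) closure_of
      {(\<beta>, \<alpha>) \<in> Delta (multinacci m). subshift_of_finite_type (Omega \<beta> \<alpha>)}"
    unfolding in_closure_of \<beta>_def[symmetric] using \<open>z \<in> Delta (multinacci m)\<close> by (auto simp: \<beta>_def)
qed

end
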